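(* Let $u\in\mathcal{C}^1(\mathbb{H})$ and $v\in\mathcal{C}^2(\mathbb{H})$ be radial, strictly convex functions such that $u\le v$. Suppose that the sets $\{g\in\mathbb{H}: u(g)<0\}$ and $\{g\in\mathbb{H}: v(g)<0\}$ coincide, denote this common set by $\Omega$, and assume that $\Omega$ is nonempty and bounded and that $$\partial\Omega=\{g\in\mathbb{H}: u(g)=0\}=\{g\in\mathbb{H}: v(g)=0\}.$$ If $\overline g\in\partial\Omega$, then there exists $\overline s=\overline s(\overline g)\in(0,1]$ such that $$\mathbb{X}v(\overline g)=\overline s\,\mathbb{X}u(\overline g).$$ In addition, suppose that the function $V$ defined by $V(r,t)=v(x,y,t)$, $r=\sqrt{x^2+y^2}$, satisfies $$r^3V_{tr}^2-V_rV_{rr}<0$$ at all points $(r,t)$ with $r>0$ corresponding to points of $\overline\Omega$. Then $$\partial_H v(\Omega)\subset\partial_H u(\Omega).$$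
   Context: The Heisenberg group $\mathbb{H}$ is $\mathbb{R}^3$ with the group law $(x,y,t)(x',y',t')=(x+x',\,y+y',\,t+t'+2(x'y-xy'))$, identity $e=(0,0,0)$, and dilations $\delta_\lambda(x,y,t)=(\lambda x,\lambda y,\lambda^2 t)$. Let $X=\partial_x+2y\,\partial_t$, $Y=\partial_y-2x\,\partial_t$ and $V_1=\mathrm{span}\{X,Y\}$, with the inner product $\langle\cdot,\cdot\rangle$ for which $X,Y$ are orthonormal; $\mathbb{X}u=(Xu)X+(Yu)Y\in V_1$. Let $\xi_1(x,y,t)=xX+yY\in V_1$. For $g_0=(x_0,y_0,t_0)\in\mathbb{H}$ the horizontal plane at $g_0$ is $H_{g_0}=\{(x,y,t): t=t_0+2y_0x-2x_0y\}$. $\mathcal{C}^k(\mathbb{H})$ denotes the functions of class $C^k$ in the usual sense on $\mathbb{R}^3$. A function $u:\mathbb{H}\to\mathbb{R}$ is radial if $u(x,y,t)=U(r,t)$ for some function $U$, where $r=\sqrt{x^2+y^2}$. It is convex if $u(g\delta_\lambda(g^{-1}g'))\le u(g)+\lambda(u(g')-u(g))$ for all $g\in\mathbb{H}$, $g'\in H_g$, $\lambda\in[0,1]$; it is strictly convex if it is convex and, whenever $g\ne g'$, equality holds only for $\lambda=0$ or $\lambda=1$. For $u:\mathbb{H}\to\mathbb{R}$, the H-subdifferential at $g_0$ is $\partial_H u(g_0)=\{p\in V_1:\ u(g)\ge u(g_0)+\langle p,\xi_1(g)-\xi_1(g_0)\rangle\ \ \forall g\in H_{g_0}\}$, and $\partial_H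 u(E)=\bigcup_{g\in E}\partial_H u(g)$ for $E\subset\mathbb{H}$. *)

theory Defs
  imports "HOL-Analysis.Analysis"
begin

type_synonym heis = "real \<times> real \<times> real"

fun heis_mult :: "heis \<Rightarrow> heis \<Rightarrow> heis" where
  "heis_mult (x, y, t) (x', y', t') = (x + x', y + y', t + t' + 2 * (x' * y - x * y'))"

fun heis_inv :: "heis \<Rightarrow> heis" where
  "heis_inv (x, y, t) = (- x, - y, - t)"

lemma heis_inv_left: "heis_mult (heis_inv g) g = (0, 0, 0)"
  by (cases g) simp

lemma heis_inv_right: "heis_mult g (heis_inv g) = (0, 0, 0)"
  by (cases g) simp

fun heis_dilation :: "real \<Rightarrow> heis \<Rightarrow> heis" where
  "heis_dilation l (x, y, t) = (l * x, l * y, l\<^sup>2 * t)"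

text \<open>The vector fields \<open>X = \<partial>\<^sub>x + 2y \<partial>\<^sub>t\<close> and \<open>Y = \<partial>\<^sub>y - 2x \<partial>\<^sub>t\<close>, given by their
  components with respect to \<open>\<partial>\<^sub>x, \<partial>\<^sub>y, \<partial>\<^sub>t\<close>.\<close>

fun fieldX :: "heis \<Rightarrow> heis" where
  "fieldX (x, y, t) = (1, 0, 2 * y)"

fun fieldY :: "heis \<Rightarrow> heis" where
  "fieldY (x, y, t) = (0, 1, - 2 * x)"

text \<open>An element \<open>a X + b Y\<close> of the first layer \<open>V\<^sub>1 = span {X, Y}\<close> is represented by its
  coordinates \<open>(a, b)\<close>.  Since \<open>X, Y\<close> are orthonormal, the inner product of \<open>V\<^sub>1\<close> is the
  standard inner product of \<open>real \<times> real\<close>.\<close>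

type_synonym layer1 = "real \<times> real"

definition horizontal_gradient :: "(heis \<Rightarrow> real) \<Rightarrow> heis \<Rightarrow> layer1" where
  "horizontal_gradient u g =
     (frechet_derivative u (at g) (fieldX g), frechet_derivative u (at g) (fieldY g))"

fun xi1 :: "heis \<Rightarrow> layer1" where
  "xi1 (x, y, t) = (x, y)"

fun horizontal_plane :: "heis \<Rightarrow> heis set" where
  "horizontal_plane (x0, y0, t0) = {(x, y, t). t = t0 + 2 * y0 * x - 2 * x0 * y}"

text \<open>Functions of class \<open>C\<^sup>k\<close> on the whole space: \<open>f\<close> is \<open>C\<^sup>k\<^sup>+\<^sup>1\<close> iff it is (Frechet)
  differentiable and all its partial derivatives are \<open>C\<^sup>k\<close>.\<close>

primrec class_C :: "nat \<Rightarrow> ('a::euclidean_space \<Rightarrow> real) \<Rightarrow> bool" where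
  "class_C 0 f \<longleftrightarrow> continuous_on UNIV f"
| "class_C (Suc k) f \<longleftrightarrow>
     (\<forall>x. f differentiable (at x)) \<and>
     (\<forall>b\<in>Basis. class_C k (\<lambda>x. frechet_derivative f (at x) b))"

definition has_radial_profile :: "(heis \<Rightarrow> real) \<Rightarrow> (real \<Rightarrow> real \<Rightarrow> real) \<Rightarrow> bool" where
  "has_radial_profile u U \<longleftrightarrow> (\<forall>x y t. u (x, y, t) = U (sqrt (x\<^sup>2 + y\<^sup>2)) t)"

definition radial :: "(heis \<Rightarrow> real) \<Rightarrow> bool" where
  "radial u \<longleftrightarrow> (\<exists>U. has_radial_profile u U)"

definition heis_segment :: "heis \<Rightarrow> heis \<Rightarrow> real \<Rightarrow> heis" where
  "heis_segment g g' l = heis_mult g (heis_dilation l (heis_mult (heis_inv g) g'))"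

definition heis_convex :: "(heis \<Rightarrow> real) \<Rightarrow> bool" where
  "heis_convex u \<longleftrightarrow>
     (\<forall>g. \<forall>g'\<in>horizontal_plane g. \<forall>l\<in>{0..1}.
        u (heis_segment g g' l) \<le> u g + l * (u g' - u g))"

definition heis_strictly_convex :: "(heis \<Rightarrow> real) \<Rightarrow> bool" where
  "heis_strictly_convex u \<longleftrightarrow>
     heis_convex u \<and>
     (\<forall>g. \<forall>g'\<in>horizontal_plane g. \<forall>l\<in>{0..1}.
        g \<noteq> g' \<longrightarrow> u (heis_segment g g' l) = u g + l * (u g' - u g) \<longrightarrow> l = 0 \<or> l = 1)"

definition H_subdifferential :: "(heis \<Rightarrow> real) \<Rightarrow> heis \<Rightarrow> layer1 set" where
  "H_subdifferential u g0 =
     {p. \<forall>g\<in>horizontal_plane g0. u g \<ge> u g0 + p \<bullet> (xi1 g - xi1 g0)}"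

definition H_subdifferential_set :: "(heis \<Rightarrow> real) \<Rightarrow> heis set \<Rightarrow> layer1 set" where
  "H_subdifferential_set u E = (\<Union>g\<in>E. H_subdifferential u g)"

text \<open>Partial derivatives of \<open>V (r, t)\<close>.  A radial profile is determined only for \<open>r \<ge> 0\<close>, so
  for a profile these are meaningful only at \<open>r > 0\<close>.\<close>

definition part_r :: "(real \<Rightarrow> real \<Rightarrow> real) \<Rightarrow> real \<Rightarrow> real \<Rightarrow> real" where
  "part_r V = (\<lambda>r t. deriv (\<lambda>s. V s t) r)"

definition part_t :: "(real \<Rightarrow> real \<Rightarrow> real) \<Rightarrow> real \<Rightarrow> real \<Rightarrow> real" where
  "part_t V = (\<lambda>r t. deriv (\<lambda>s. V r s) t)"

end

theory Submission
  imports Defs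
begin

text \<open>Touching from below on \<open>frontier \<Omega>\<close> forces equal derivatives there, so the first claim
  holds with \<open>s = 1\<close>.  For the second claim the subdifferentials are the horizontal gradients
  \<open>\<nabla>\<close>, and these commute with rotations about the \<open>t\<close>-axis, so only their lengths on the half-plane
  \<open>y = 0\<close>, \<open>x \<ge> 0\<close> matter.  There \<open>|\<nabla>v|\<^sup>2 = V\<^sub>r\<^sup>2 + 4 r\<^sup>2 V\<^sub>t\<^sup>2\<close> has the
  \<open>r\<close>-derivative \<open>2 (V\<^sub>r V\<^sub>r\<^sub>r + 4 r V\<^sub>t\<^sup>2 + 4 r\<^sup>2 V\<^sub>t V\<^sub>t\<^sub>r)\<close>, and the hypothesis
  says that this quadratic polynomial in \<open>V\<^sub>t\<close> has negative discriminant.  Hence \<open>|\<nabla>v|\<close>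
  increases along each ray \<open>t = const\<close> up to the point where the ray leaves \<open>\<Omega>\<close>; there it agrees
  with \<open>|\<nabla>u|\<close>, which vanishes on the axis and so takes all smaller values on the ray.\<close>

subsection \<open>Subdifferential and horizontal gradient\<close>

text \<open>The value at \<open>g\<close> of the left-invariant field with coordinates
  \<open>p\<close>. The map sending \<open>w\<close> to \<open>g + horizontal_vector g w\<close> is
  an affine chart of the horizontal plane at \<open>g\<close>, so questions about H-subdifferentials
  become Euclidean ones in the plane.\<close>

definition horizontal_vector :: "heis \<Rightarrow> layer1 \<Rightarrow> heis" where
  "horizontal_vector g p = fst p *\<^sub>R fieldX g + snd p *\<^sub>R fieldY g"

lemma horizontal_vector_eq:
  "horizontal_vector (x, y, t) (a, b) = (a, b, 2 * (a * y - b * x))"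
  by (simp add: horizontal_vector_def algebra_simps)

lemma bounded_linear_horizontal_vector: "bounded_linear (horizontal_vector g)"
  unfolding horizontal_vector_def by (intro bounded_linear_intros)

lemma frechet_derivative_horizontal_vector:
  assumes "u differentiable (at g)"
  shows "frechet_derivative u (at g) (horizontal_vector g p) = horizontal_gradient u g \<bullet> p"
proof -
  have "linear (frechet_derivative u (at g))"
    by (rule linear_frechet_derivative[OF assms])
  then show ?thesis
    by (cases p)
      (simp add: horizontal_vector_def horizontal_gradient_def linear_add linear_scale)
qed

lemma horizontal_plane_iff:
  "g' \<in> horizontal_plane g \<longleftrightarrow> g' = g + horizontal_vector g (xi1 g' - xi1 g)"
  by (cases g; cases g') (auto simp: horizontal_vector_eq algebra_simps)

lemma xi1_add_horizontal_vector: "xi1 (g + horizontal_vector g p) = xi1 g + p"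
  by (cases g; cases p) (simp add: horizontal_vector_eq)

lemma add_horizontal_vector_in_plane: "g + horizontal_vector g p \<in> horizontal_plane g"
  by (simp add: horizontal_plane_iff xi1_add_horizontal_vector)

text \<open>Inside the plane of \<open>g\<close> the increment from \<open>g\<close> has zero
  \<open>t\<close>-component, so the quadratic factor of the dilation acts on 0 and Heisenberg
  segments are straight segments in the chart.\<close>

lemma heis_segment_horizontal:
  "heis_segment g (g + horizontal_vector g p) l = g + horizontal_vector g (l *\<^sub>R p)"
  by (cases g; cases p) (simp add: heis_segment_def horizontal_vector_eq algebra_simps)

text \<open>In the chart the H-subdifferential is the ordinary subdifferential at 0 of the
  restriction of \<open>u\<close> to the plane.\<close>

lemma H_subdifferential_iff:
  "p \<in> H_subdifferential u g \<longleftrightarrow> (\<forall>w. u g + p \<bullet> w \<le> u (g + horizontal_vector g w))"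
proof
  assume "p \<in> H_subdifferential u g"
  then have "\<forall>g'\<in>horizontal_plane g. u g + p \<bullet> (xi1 g' - xi1 g) \<le> u g'"
    by (simp add: H_subdifferential_def)
  from bspec[OF this add_horizontal_vector_in_plane]
  show "\<forall>w. u g + p \<bullet> w \<le> u (g + horizontal_vector g w)"
    by (simp add: xi1_add_horizontal_vector del: split_paired_All)
next
  assume *: "\<forall>w. u g + p \<bullet> w \<le> u (g + horizontal_vector g w)"
  have "u g + p \<bullet> (xi1 g' - xi1 g) \<le> u g'" if "g' \<in> horizontal_plane g" for g'
    using spec[OF *, of "xi1 g' - xi1 g"] that[unfolded horizontal_plane_iff]
    by (simp only: flip: that[unfolded horizontal_plane_iff])
  then show "p \<in> H_subdifferential u g"
    by (simp add: H_subdifferential_def)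
qed

lemma has_derivative_along_plane:
  assumes "u differentiable (at g)"
  shows "((\<lambda>w. u (g + horizontal_vector g w)) has_derivative (\<lambda>w. horizontal_gradient u g \<bullet> w)) (at 0)"
proof -
  have h0: "horizontal_vector g 0 = 0"
    by (simp add: horizontal_vector_def)
  have "((\<lambda>w. g + horizontal_vector g w) has_derivative horizontal_vector g) (at 0)"
    using has_derivative_add[OF has_derivative_const
        bounded_linear_imp_has_derivative[OF bounded_linear_horizontal_vector[of g]]]
    by simp
  moreover have "(u has_derivative frechet_derivative u (at g)) (at (g + horizontal_vector g 0))"
    using assms by (simp add: h0 frechet_derivative_works)
  ultimately have "(u \<circ> (\<lambda>w. g + horizontal_vector g w) has_derivative
      frechet_derivative u (at g) \<circ> horizontal_vector g) (at 0)"
    by (rule diff_chain_at)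
  then show ?thesis
    by (simp add: o_def frechet_derivative_horizontal_vector[OF assms])
qed

text \<open>Subtracting the supporting linear function leaves a function on the chart with a minimum
  at 0, where its derivative must vanish.\<close>

lemma H_subdifferential_imp_gradient:
  assumes "u differentiable (at g)" and "p \<in> H_subdifferential u g"
  shows "p = horizontal_gradient u g"
proof -
  define f where "f w = u (g + horizontal_vector g w) - p \<bullet> w" for w
  have h0: "horizontal_vector g 0 = 0"
    by (simp add: horizontal_vector_def)
  have "(f has_derivative (\<lambda>w. horizontal_gradient u g \<bullet> w - p \<bullet> w)) (at 0)"
    unfolding f_def
    by (intro has_derivative_diff has_derivative_along_plane assms(1)
        bounded_linear_imp_has_derivative bounded_linear_inner_right)
  moreover have "f 0 \<le> f w" for w
    using assms(2)
    by (simp add: H_subdifferential_iff f_def h0 le_diff_eq del: split_paired_All)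
  ultimately have "(\<lambda>w. horizontal_gradient u g \<bullet> w - p \<bullet> w) = (\<lambda>w. 0)"
    by (intro differential_zero_maxmin[of 0 UNIV f]) auto
  then have "(horizontal_gradient u g - p) \<bullet> w = 0" for w
    by (metis inner_diff_left)
  then show ?thesis
    by (metis inner_eq_zero_iff right_minus_eq)
qed

text \<open>Along a line in the plane, convexity bounds each difference quotient by the full
  increment \<open>f 1 - f 0\<close>; the bound survives the limit at 0 from the right.\<close>

lemma gradient_in_H_subdifferential:
  assumes conv: "heis_convex u" and diff: "u differentiable (at g)"
  shows "horizontal_gradient u g \<in> H_subdifferential u g"
  unfolding H_subdifferential_iff
proof
  fix w
  define f where "f l = u (g + horizontal_vector g (l *\<^sub>R w))" for l :: real
  have h0: "horizontal_vector g 0 = 0"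
    by (simp add: horizontal_vector_def)
  have "((\<lambda>l::real. l *\<^sub>R w) has_derivative (\<lambda>l. l *\<^sub>R w)) (at 0)"
    by (intro derivative_eq_intros) auto
  then have "((\<lambda>w. u (g + horizontal_vector g w)) \<circ> (\<lambda>l::real. l *\<^sub>R w) has_derivative
      (\<lambda>w. horizontal_gradient u g \<bullet> w) \<circ> (\<lambda>l. l *\<^sub>R w)) (at 0)"
    by (rule diff_chain_at) (simp add: has_derivative_along_plane[OF diff])
  then have "(f has_field_derivative horizontal_gradient u g \<bullet> w) (at 0)"
    by (simp add: has_field_derivative_def f_def[abs_def] o_def mult.commute[of _ "_ \<bullet> _"])
  then have lim: "((\<lambda>l. (f l - f 0) / l) \<longlongrightarrow> horizontal_gradient u g \<bullet> w) (at_right 0)"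
    by (auto simp: has_field_derivative_iff intro: filterlim_mono[OF _ order_refl at_le])
  have "(f l - f 0) / l \<le> f 1 - f 0" if "0 < l" "l < 1" for l
  proof -
    have "u (heis_segment g (g + horizontal_vector g w) l)
        \<le> u g + l * (u (g + horizontal_vector g w) - u g)"
      using conv that add_horizontal_vector_in_plane[of g w] unfolding heis_convex_def
      by (metis atLeastAtMost_iff less_imp_le)
    then show ?thesis
      using that by (simp add: heis_segment_horizontal f_def h0 divide_simps algebra_simps)
  qed
  then have "\<forall>\<^sub>F l in at_right 0. (f l - f 0) / l \<le> f 1 - f 0"
    using eventually_at_right_real[of 0 1] by (auto elim: eventually_mono)
  then have "horizontal_gradient u g \<bullet> w \<le> f 1 - f 0"
    by (intro tendsto_upperbound[OF lim]) auto
  then show "u g + horizontal_gradient u g \<bullet> w \<le> u (g + horizontal_vector g w)"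
    by (simp add: f_def h0)
qed

subsection \<open>Symmetries of radial functions\<close>

text \<open>Chain rule for \<open>u o A = u\<close> and uniqueness of the derivative,
  \<open>A\<close> being its own derivative.\<close>

lemma frechet_derivative_invariant:
  assumes A: "bounded_linear A" and inv: "\<And>g. u (A g) = u g"
    and diff: "\<And>g. u differentiable (at g)"
  shows "frechet_derivative u (at (A g)) (A w) = frechet_derivative u (at g) w"
proof -
  have "(u \<circ> A has_derivative frechet_derivative u (at (A g)) \<circ> A) (at g)"
    using diff by (intro diff_chain_at bounded_linear_imp_has_derivative A)
      (simp add: frechet_derivative_works)
  moreover have "u \<circ> A = u"
    using inv by auto
  ultimately have "frechet_derivative u (at g) = frechet_derivative u (at (A g)) \<circ> A"
    by (metis frechet_derivative_at)
  then show ?thesis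
    by simp
qed

text \<open>The pair \<open>c\<close>, \<open>s\<close> stands for cosine and sine of an angle; the
  relation \<open>c^2 + s^2 = 1\<close> is assumed where it matters, which keeps all computations
  polynomial.\<close>

definition rot :: "real \<Rightarrow> real \<Rightarrow> heis \<Rightarrow> heis" where
  "rot c s = (\<lambda>(x, y, t). (c * x - s * y, s * x + c * y, t))"

lemma bounded_linear_rot: "bounded_linear (rot c s)"
  unfolding rot_def case_prod_unfold
  by (intro bounded_linear_Pair bounded_linear_sub bounded_linear_add
      bounded_linear_compose[OF bounded_linear_mult_right]
      bounded_linear_compose[OF bounded_linear_fst]
      bounded_linear_compose[OF bounded_linear_snd]
      bounded_linear_fst bounded_linear_snd bounded_linear_ident)

lemma rot_sum_squares:
  fixes c s x y :: real
  assumes "c\<^sup>2 + s\<^sup>2 = 1"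
  shows "(c * x - s * y)\<^sup>2 + (s * x + c * y)\<^sup>2 = x\<^sup>2 + y\<^sup>2"
proof -
  have "(c * x - s * y)\<^sup>2 + (s * x + c * y)\<^sup>2 = (c\<^sup>2 + s\<^sup>2) * (x\<^sup>2 + y\<^sup>2)"
    by algebra
  then show ?thesis
    using assms by simp
qed

lemma radial_rot:
  assumes "radial u" "c\<^sup>2 + s\<^sup>2 = 1"
  shows "u (rot c s g) = u g"
  using assms
  by (cases g) (auto simp: radial_def has_radial_profile_def rot_def rot_sum_squares)

text \<open>Rotations about the \<open>t\<close>-axis carry horizontal vectors at \<open>g\<close>
  to horizontal vectors at the rotated point and rotate their coordinates, so invariance of the
  derivative becomes equivariance of the gradient.\<close>

lemma horizontal_gradient_rot:
  assumes "radial u" and diff: "\<And>g. u differentiable (at g)" and cs: "c\<^sup>2 + s\<^sup>2 = 1"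
    and g: "horizontal_gradient u g = (a, b)"
  shows "horizontal_gradient u (rot c s g) = (c * a - s * b, s * a + c * b)"
proof -
  obtain x y t where xyt: "g = (x, y, t)"
    by (cases g)
  obtain a' b' where ab': "horizontal_gradient u (rot c s g) = (a', b')"
    by fastforce
  have "horizontal_vector (rot c s g) (c * p - s * q, s * p + c * q)
      = rot c s (horizontal_vector g (p, q))" for p q
  proof -
    \<comment> \<open>The \<open>t\<close>-component is a 2 by 2 determinant, which a rotation
      preserves.\<close>
    have "2 * ((c * p - s * q) * (s * x + c * y) - (s * p + c * q) * (c * x - s * y))
        = (c\<^sup>2 + s\<^sup>2) * (2 * (p * y - q * x))"
      by algebra
    then show ?thesis
      using cs by (simp add: xyt rot_def horizontal_vector_eq)
  qed
  then have *: "(a', b') \<bullet> (c * p - s * q, s * p + c * q) = (a, b) \<bullet> (p, q)" for p q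
    using frechet_derivative_horizontal_vector[OF diff]
      frechet_derivative_invariant[OF bounded_linear_rot radial_rot[OF assms(1) cs] diff]
    by (metis ab' g)
  \<comment> \<open>The test vectors \<open>(c, - s)\<close> and \<open>(s, c)\<close> are those
    rotated onto the coordinate axes, so they isolate \<open>a'\<close> and
    \<open>b'\<close>.\<close>
  have "a' * (c\<^sup>2 + s\<^sup>2) = c * a - s * b"
    using *[of c "- s"] by (simp add: power2_eq_square algebra_simps)
  moreover have "b' * (c\<^sup>2 + s\<^sup>2) = s * a + c * b"
    using *[of s c] by (simp add: power2_eq_square algebra_simps)
  ultimately show ?thesis
    by (simp add: ab' cs)
qed

lemma norm_horizontal_gradient_rot:
  assumes "radial u" and "\<And>g. u differentiable (at g)" and "c\<^sup>2 + s\<^sup>2 = 1"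
  shows "norm (horizontal_gradient u (rot c s g)) = norm (horizontal_gradient u g)"
  using horizontal_gradient_rot[OF assms, of g] rot_sum_squares[OF assms(3)]
  by (cases "horizontal_gradient u g") (simp add: norm_prod_def)

lemma rotation_transitive:
  fixes a b a' b' :: real
  assumes "a\<^sup>2 + b\<^sup>2 = a'\<^sup>2 + b'\<^sup>2"
  obtains c s where "c\<^sup>2 + s\<^sup>2 = 1" "a' = c * a - s * b" "b' = s * a + c * b"
proof (cases "a\<^sup>2 + b\<^sup>2 = 0")
  case True
  then have "a = 0" "b = 0" "a' = 0" "b' = 0"
    using assms by (simp_all add: sum_power2_eq_zero_iff)
  then show ?thesis
    using that[of 1 0] by simp
next
  case False
  \<comment> \<open>In complex notation \<open>c + i s\<close> is the quotient of
    \<open>a' + i b'\<close> by \<open>a + i b\<close>, computed with the conjugate of the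
    denominator.\<close>
  define n where "n = a\<^sup>2 + b\<^sup>2"
  define c where "c = (a * a' + b * b') / n"
  define s where "s = (a * b' - b * a') / n"
  have n: "n \<noteq> 0"
    using False by (simp add: n_def)
  have cn: "c * n = a * a' + b * b'" and sn: "s * n = a * b' - b * a'"
    using n by (simp_all add: c_def s_def)
  have "(c * n)\<^sup>2 + (s * n)\<^sup>2 = (a\<^sup>2 + b\<^sup>2) * (a'\<^sup>2 + b'\<^sup>2)"
    unfolding cn sn by algebra
  also have "\<dots> = n * n"
    using assms by (simp add: n_def)
  finally have "(c\<^sup>2 + s\<^sup>2) * n\<^sup>2 = 1 * n\<^sup>2"
    by (simp add: power2_eq_square algebra_simps)
  then have 1: "c\<^sup>2 + s\<^sup>2 = 1"
    using n by (simp only: mult_cancel_right) simp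
  have "(c * n) * a - (s * n) * b = n * a'" "(s * n) * a + (c * n) * b = n * b'"
    unfolding cn sn by (simp_all add: n_def power2_eq_square algebra_simps)
  then have "n * (c * a - s * b) = n * a'" "n * (s * a + c * b) = n * b'"
    by (simp_all add: algebra_simps)
  then show ?thesis
    using that[OF 1] n by auto
qed

lemma rot_to_half_plane:
  obtains c s where "c\<^sup>2 + s\<^sup>2 = 1" "(x, y, t) = rot c s (sqrt (x\<^sup>2 + y\<^sup>2), 0, t)"
  by (rule rotation_transitive[of "sqrt (x\<^sup>2 + y\<^sup>2)" 0 x y]) (auto simp: rot_def)

text \<open>The half turn \<open>c = -1\<close>, \<open>s = 0\<close> fixes the axis and negates the
  gradient there.\<close>

lemma horizontal_gradient_axis:
  assumes "radial u" and "\<And>g. u differentiable (at g)"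
  shows "horizontal_gradient u (0, 0, t) = 0"
proof -
  obtain a b where ab: "horizontal_gradient u (0, 0, t) = (a, b)"
    by fastforce
  then have "a = 0" "b = 0"
    using horizontal_gradient_rot[OF assms, of "-1" 0 "(0, 0, t)" a b]
    by (simp_all add: rot_def)
  then show ?thesis
    by (simp only: ab zero_prod_def)
qed

text \<open>The reflection in \<open>y\<close> fixes the points with \<open>y = 0\<close> and so
  kills the \<open>y\<close>-derivative of a radial function. It is not a group automorphism, hence
  it is applied to the Euclidean derivative.\<close>

lemma horizontal_gradient_half_plane:
  assumes "radial u" and diff: "\<And>g. u differentiable (at g)"
  shows "horizontal_gradient u (x, 0, t) =
    (frechet_derivative u (at (x, 0, t)) (1, 0, 0),
     - 2 * x * frechet_derivative u (at (x, 0, t)) (0, 0, 1))"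
proof -
  define refl :: "heis \<Rightarrow> heis" where "refl = (\<lambda>(x, y, t). (x, - y, t))"
  let ?D = "frechet_derivative u (at (x, 0, t))"
  have lin: "linear ?D"
    by (rule linear_frechet_derivative[OF diff])
  have bl: "bounded_linear refl"
    unfolding refl_def case_prod_unfold
    by (intro bounded_linear_Pair bounded_linear_minus
        bounded_linear_compose[OF bounded_linear_fst]
        bounded_linear_compose[OF bounded_linear_snd]
        bounded_linear_fst bounded_linear_snd bounded_linear_ident)
  have "u (refl g) = u g" for g
    using assms(1) by (cases g) (auto simp: radial_def has_radial_profile_def refl_def)
  from frechet_derivative_invariant[OF bl this diff, of "(x, 0, t)" "(0, 1, 0)"]
  have "?D (0, -1, 0) = ?D (0, 1, 0)"
    by (simp add: refl_def)
  moreover have "?D (0, -1, 0) = - ?D (0, 1, 0)"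
    using linear_neg[OF lin, of "(0, 1, 0)"] by simp
  ultimately have "?D (0, 1, 0) = 0"
    by simp
  moreover have "?D (0, 1, - 2 * x) = ?D (0, 1, 0) + (- 2 * x) * ?D (0, 0, 1)"
    using linear_add[OF lin, of "(0, 1, 0)" "(- 2 * x) *\<^sub>R (0, 0, 1)"]
      linear_scale[OF lin, of "- 2 * x" "(0, 0, 1)"]
    by simp
  ultimately show ?thesis
    by (simp add: horizontal_gradient_def)
qed

lemma heis_Basis [simp]:
  "(1, 0, 0) \<in> (Basis :: heis set)" "(0, 1, 0) \<in> (Basis :: heis set)"
  "(0, 0, 1) \<in> (Basis :: heis set)"
  by (auto simp: Basis_prod_def zero_prod_def)

lemma continuous_on_norm_gradient_half_plane:
  assumes "class_C 1 u" and "radial u"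
  shows "continuous_on S (\<lambda>x. norm (horizontal_gradient u (x, 0, t)))"
proof -
  have "continuous_on UNIV (\<lambda>g. frechet_derivative u (at g) b)" if "b \<in> Basis" for b
    using assms(1) that by simp
  then have "continuous_on S (\<lambda>x. frechet_derivative u (at (x, 0, t)) b)" if "b \<in> Basis" for b
    by (rule continuous_on_compose2[where f = "\<lambda>x. (x, 0, t)"
          and g = "\<lambda>g. frechet_derivative u (at g) b" and t = UNIV, OF _ _ subset_UNIV])
      (use that in \<open>auto intro: continuous_on_Pair continuous_on_id continuous_on_const\<close>)
  moreover have "\<And>g. u differentiable (at g)"
    using assms(1) by (simp del: split_paired_All)
  ultimately show ?thesis
    by (simp add: horizontal_gradient_half_plane[OF assms(2)])
      (intro continuous_intros; simp)
qed

subsection \<open>Monotonicity of the gradient along rays\<close>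

lemma DERIV_frechet_x:
  fixes f :: "heis \<Rightarrow> real"
  assumes "f differentiable (at (x, y, t))"
  shows "((\<lambda>s. f (s, y, t)) has_field_derivative frechet_derivative f (at (x, y, t)) (1, 0, 0)) (at x)"
    (is "(_ has_field_derivative ?D (1, 0, 0)) _")
proof -
  have "((\<lambda>s::real. (s, y, t)) has_derivative (\<lambda>s. (s, 0, 0))) (at x)"
    by (intro derivative_eq_intros) auto
  then have "(f \<circ> (\<lambda>s. (s, y, t)) has_derivative ?D \<circ> (\<lambda>s. (s, 0, 0))) (at x)"
    using assms by (intro diff_chain_at) (simp_all only: frechet_derivative_works)
  moreover have "?D \<circ> (\<lambda>s. (s, 0, 0)) = (*) (?D (1, 0, 0))"
  proof
    fix s
    show "(?D \<circ> (\<lambda>s. (s, 0, 0))) s = ?D (1, 0, 0) * s"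
      using linear_scale[OF linear_frechet_derivative[OF assms], of s "(1, 0, 0)"]
      by (simp add: mult.commute)
  qed
  ultimately show ?thesis
    by (simp only: has_field_derivative_def o_def)
qed

lemma DERIV_frechet_t:
  fixes f :: "heis \<Rightarrow> real"
  assumes "f differentiable (at (x, y, t))"
  shows "((\<lambda>s. f (x, y, s)) has_field_derivative frechet_derivative f (at (x, y, t)) (0, 0, 1)) (at t)"
    (is "(_ has_field_derivative ?D (0, 0, 1)) _")
proof -
  have "((\<lambda>s::real. (x, y, s)) has_derivative (\<lambda>s. (0, 0, s))) (at t)"
    by (intro derivative_eq_intros) auto
  then have "(f \<circ> (\<lambda>s. (x, y, s)) has_derivative ?D \<circ> (\<lambda>s. (0, 0, s))) (at t)"
    using assms by (intro diff_chain_at) (simp_all only: frechet_derivative_works)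
  moreover have "?D \<circ> (\<lambda>s. (0, 0, s)) = (*) (?D (0, 0, 1))"
  proof
    fix s
    show "(?D \<circ> (\<lambda>s. (0, 0, s))) s = ?D (0, 0, 1) * s"
      using linear_scale[OF linear_frechet_derivative[OF assms], of s "(0, 0, 1)"]
      by (simp add: mult.commute)
  qed
  ultimately show ?thesis
    by (simp only: has_field_derivative_def o_def)
qed

text \<open>A profile is determined only at positive radii, but a derivative at \<open>x > 0\<close>
  sees nothing else.\<close>

lemma deriv_cong_pos:
  assumes "\<And>s. 0 < s \<Longrightarrow> f s = h s" and "0 < (x::real)"
  shows "deriv f x = deriv h x"
proof (rule deriv_cong_ev)
  show "\<forall>\<^sub>F s in nhds x. f s = h s"
    using eventually_nhds_in_open[of "{0<..}" x] assms by (auto elim: eventually_mono)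
qed simp

text \<open>The partial derivatives of \<open>V\<close> are given by the total function
  \<open>deriv\<close>, which by itself guarantees no differentiability. Rewriting them through
  \<open>v\<close> on the half-plane \<open>y = 0\<close> turns them into genuine
  derivatives.\<close>

lemma profile_derivatives:
  assumes v: "class_C 2 v" and prof: "has_radial_profile v V" and x: "0 < x"
  defines "vx \<equiv> \<lambda>g. frechet_derivative v (at g) (1, 0, 0)"
    and "vt \<equiv> \<lambda>g. frechet_derivative v (at g) (0, 0, 1)"
  shows "part_r V x t = vx (x, 0, t)"
    and "((\<lambda>s. vx (s, 0, t)) has_field_derivative part_r (part_r V) x t) (at x)"
    and "((\<lambda>s. vt (s, 0, t)) has_field_derivative part_r (part_t V) x t) (at x)"
proof -
  have V: "V s \<tau> = v (s, 0, \<tau>)" if "0 < s" for s \<tau>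
    using prof that unfolding has_radial_profile_def by (metis add.right_neutral
        less_imp_le power_zero_numeral real_sqrt_unique)
  have dv: "v differentiable (at g)" "vx differentiable (at g)" "vt differentiable (at g)" for g
    using v by (simp_all add: numeral_2_eq_2 vx_def vt_def del: split_paired_All)
  have r: "part_r V s t = vx (s, 0, t)" if "0 < s" for s
    using deriv_cong_pos[of "\<lambda>s. V s t" "\<lambda>s. v (s, 0, t)", OF V that]
      DERIV_imp_deriv[OF DERIV_frechet_x[OF dv(1)]] by (simp add: part_r_def vx_def)
  have t: "part_t V s t = vt (s, 0, t)" if "0 < s" for s
  proof -
    have "V s = (\<lambda>\<tau>. v (s, 0, \<tau>))"
      using V[OF that] by blast
    then show ?thesis
      using DERIV_imp_deriv[OF DERIV_frechet_t[OF dv(1)]] by (simp add: part_t_def vt_def)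
  qed
  show "part_r V x t = vx (x, 0, t)"
    by (rule r[OF x])
  have "part_r (part_r V) x t = deriv (\<lambda>s. vx (s, 0, t)) x"
    unfolding part_r_def[of "part_r V"] by (rule deriv_cong_pos[OF r x])
  then show "((\<lambda>s. vx (s, 0, t)) has_field_derivative part_r (part_r V) x t) (at x)"
    using DERIV_frechet_x[OF dv(2)] by (metis DERIV_imp_deriv)
  have "part_r (part_t V) x t = deriv (\<lambda>s. vt (s, 0, t)) x"
    unfolding part_r_def[of "part_t V"] by (rule deriv_cong_pos[OF t x])
  then show "((\<lambda>s. vt (s, 0, t)) has_field_derivative part_r (part_t V) x t) (at x)"
    using DERIV_frechet_x[OF dv(3)] by (metis DERIV_imp_deriv)
qed

lemma class_C_2_imp_1: "class_C 2 f \<Longrightarrow> class_C 1 f"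
  by (auto simp: numeral_2_eq_2 intro!: differentiable_imp_continuous_on
      simp: differentiable_on_def differentiable_at_withinI)

lemma norm_gradient_strict_increasing:
  assumes v: "class_C 2 v" and prof: "has_radial_profile v V"
    and neg: "\<And>x. 0 < x \<Longrightarrow> x < R \<Longrightarrow>
      x ^ 3 * (part_r (part_t V) x t)\<^sup>2 - part_r V x t * part_r (part_r V) x t < 0"
    and x: "0 \<le> x" "x < R"
  shows "norm (horizontal_gradient v (x, 0, t)) < norm (horizontal_gradient v (R, 0, t))"
proof -
  \<comment> \<open>The square of the norm stays differentiable where the gradient vanishes.\<close>
  define \<phi> where "\<phi> x = (norm (horizontal_gradient v (x, 0, t)))\<^sup>2" for x
  have rad: "radial v"
    using prof by (auto simp: radial_def)
  have v1: "class_C 1 v"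
    by (rule class_C_2_imp_1[OF v])
  let ?vx = "\<lambda>s. frechet_derivative v (at (s, 0, t)) (1, 0, 0)"
  let ?vt = "\<lambda>s. frechet_derivative v (at (s, 0, t)) (0, 0, 1)"
  have "\<And>g. v differentiable (at g)"
    using v1 by (simp del: split_paired_All)
  then have \<phi>: "\<phi> = (\<lambda>s. (?vx s)\<^sup>2 + 4 * s\<^sup>2 * (?vt s)\<^sup>2)"
    by (auto simp: \<phi>_def[abs_def] horizontal_gradient_half_plane[OF rad] norm_prod_def
        power_mult_distrib)
  have "\<phi> x < \<phi> R"
  \<comment> \<open>The derivative is needed only in the open interval; continuity covers the
    endpoints, in particular \<open>x = 0\<close>, where the profile says nothing.\<close>
  proof (rule DERIV_pos_imp_increasing_open[OF x(2)])
    fix s assume s: "x < s" "s < R"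
    then have s0: "0 < s"
      using x by simp
    let ?a = "?vx s" and ?b = "?vt s"
      and ?a' = "part_r (part_r V) s t" and ?b' = "part_r (part_t V) s t"
    note d = profile_derivatives[OF v prof s0, of t]
    have "(\<phi> has_field_derivative 2 * ?a * ?a' + 8 * s * ?b\<^sup>2 + 8 * s\<^sup>2 * ?b * ?b') (at s)"
      unfolding \<phi> by (rule derivative_eq_intros d refl)+ (simp add: power2_eq_square)
    moreover have "s ^ 3 * ?b'\<^sup>2 < ?a * ?a'"
      using neg[OF s0 s(2)] d(1) by simp
    \<comment> \<open>Replacing \<open>?a * ?a'\<close> by its strict lower bound
      \<open>s^3 * ?b'^2\<close> turns the derivative of \<open>\<phi>\<close> into exactly this
      square.\<close>
    moreover have "0 \<le> 2 * s * (s * ?b' + 2 * ?b)\<^sup>2"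
      using s0 by simp
    then have "0 \<le> 2 * (s ^ 3 * ?b'\<^sup>2) + 8 * s * ?b\<^sup>2 + 8 * s\<^sup>2 * ?b * ?b'"
      by (simp add: power2_eq_square power3_eq_cube algebra_simps)
    ultimately show "\<exists>y. (\<phi> has_field_derivative y) (at s) \<and> 0 < y"
      by (intro exI conjI) auto
  next
    show "continuous_on {x..R} \<phi>"
      unfolding \<phi>_def
      by (intro continuous_intros continuous_on_norm_gradient_half_plane v1 rad)
  qed
  then show ?thesis
    unfolding \<phi>_def by (rule power_less_imp_less_base) simp
qed

section \<open>Rays from the axis and contact on the boundary\<close>

lemma radial_strictly_convex_less:
  assumes "radial u" and conv: "heis_strictly_convex u" and x: "0 \<le> x" "x < R"
  shows "u (x, 0, t) < u (R, 0, t)"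
proof -
  \<comment> \<open>The antipodal points \<open>(- R, 0, t)\<close> and \<open>(R, 0, t)\<close>
    share a horizontal plane and, by radiality, a value of \<open>u\<close>. The parameter
    \<open>l\<close> solves \<open>- R + 2 * R * l = x\<close> and places \<open>(x, 0, t)\<close>
    strictly between them.\<close>
  define l where "l = (x + R) / (2 * R)"
  have l: "0 < l" "l < 1" "2 * R * l = x + R"
    using x by (auto simp: l_def field_simps)
  have even: "u (- R, 0, t) = u (R, 0, t)"
    using assms(1) by (auto simp: radial_def has_radial_profile_def)
  have plane: "(R, 0, t) \<in> horizontal_plane (- R, 0, t)"
    by simp
  have seg: "heis_segment (- R, 0, t) (R, 0, t) l = (x, 0, t)"
    using l(3) by (simp add: heis_segment_def algebra_simps)
  have "u (x, 0, t) \<le> u (R, 0, t)"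
    using conv plane l seg even
    unfolding heis_strictly_convex_def heis_convex_def
    by (metis atLeastAtMost_iff diff_self less_imp_le mult_zero_right add.right_neutral)
  moreover have "u (x, 0, t) \<noteq> u (R, 0, t)"
  proof
    assume "u (x, 0, t) = u (R, 0, t)"
    then have "u (heis_segment (- R, 0, t) (R, 0, t) l)
        = u (- R, 0, t) + l * (u (R, 0, t) - u (- R, 0, t))"
      by (simp add: seg even)
    moreover have "(- R, 0, t) \<noteq> (R, 0, t)" "l \<in> {0..1}"
      using x l by auto
    ultimately have "l = 0 \<or> l = 1"
      using conv plane unfolding heis_strictly_convex_def by blast
    then show False
      using l by simp
  qed
  ultimately show ?thesis
    by simp
qed

lemma ray_exit:
  fixes v :: "heis \<Rightarrow> real"
  assumes cont: "continuous_on UNIV v" and bdd: "bounded {g. v g < 0}" and "v (r, 0, t) < 0"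
  obtains R where "r < R" "v (R, 0, t) = 0"
proof -
  obtain B where B: "\<And>g. v g < 0 \<Longrightarrow> norm g \<le> B"
    using bdd by (auto simp: bounded_iff)
  \<comment> \<open>Beyond the norm bound \<open>B\<close>, so that \<open>(M, 0, t)\<close> is
    outside the negative set, and at least \<open>r\<close>, so that the intermediate value theorem
    applies on \<open>{r..M}\<close>.\<close>
  define M where "M = max r (\<bar>B\<bar> + 1)"
  have "\<bar>M\<bar> \<le> norm (M, 0 :: real, t)"
    using norm_fst_le[of M "(0 :: real, t)"] by simp
  then have "0 \<le> v (M, 0, t)"
    using B[of "(M, 0, t)"] by (fastforce simp: M_def)
  moreover have "continuous_on {r..M} (\<lambda>x. v (x, 0, t))"
    by (rule continuous_on_compose2[OF cont])
      (auto intro: continuous_on_Pair continuous_on_id continuous_on_const)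
  moreover have "r \<le> M"
    by (simp add: M_def)
  ultimately obtain R where "r \<le> R" "v (R, 0, t) = 0"
    using IVT'[of "\<lambda>x. v (x, 0, t)" r 0 M] assms(3) by auto
  moreover from this have "r \<noteq> R"
    using assms(3) by auto
  ultimately show ?thesis
    using that by force
qed

text \<open>The difference \<open>v - u\<close> has a minimum at a contact point, so its derivative
  vanishes there.\<close>

lemma horizontal_gradient_touching:
  assumes "u differentiable (at g)" "v differentiable (at g)"
    and "\<And>g. u g \<le> v g" and "u g = v g"
  shows "horizontal_gradient v g = horizontal_gradient u g"
proof -
  have "((\<lambda>g. v g - u g) has_derivative
      (\<lambda>w. frechet_derivative v (at g) w - frechet_derivative u (at g) w)) (at g)"
    using assms(1,2) by (intro has_derivative_diff) (simp_all add: frechet_derivative_works)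
  then have "(\<lambda>w. frechet_derivative v (at g) w - frechet_derivative u (at g) w) = (\<lambda>w. 0)"
    using assms(3,4) by (intro differential_zero_maxmin[of g UNIV]) auto
  then have "frechet_derivative v (at g) w = frechet_derivative u (at g) w" for w
    by (metis right_minus_eq)
  then show ?thesis
    by (simp add: horizontal_gradient_def)
qed

theorem theorem5p2:
  fixes u v :: "heis \<Rightarrow> real" and \<Omega> :: "heis set"
  assumes "class_C 1 u" and "class_C 2 v"
    and "radial u" and "radial v"
    and "heis_strictly_convex u" and "heis_strictly_convex v"
    and "\<And>g. u g \<le> v g"
    and "\<Omega> = {g. u g < 0}" and "\<Omega> = {g. v g < 0}"
    and "\<Omega> \<noteq> {}" and "bounded \<Omega>"
    and "frontier \<Omega> = {g. u g = 0}" and "frontier \<Omega> = {g. v g = 0}"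
  shows "(\<forall>g\<in>frontier \<Omega>. \<exists>s\<in>{0<..1}.
            horizontal_gradient v g = s *\<^sub>R horizontal_gradient u g) \<and>
         (\<forall>V. has_radial_profile v V \<longrightarrow>
            (\<forall>x y t r. (x, y, t) \<in> closure \<Omega> \<and> r = sqrt (x\<^sup>2 + y\<^sup>2) \<and> r > 0 \<longrightarrow>
               r ^ 3 * (part_r (part_t V) r t)\<^sup>2 - part_r V r t * part_r (part_r V) r t < 0) \<longrightarrow>
            H_subdifferential_set v \<Omega> \<subseteq> H_subdifferential_set u \<Omega>)"
proof -
  have du: "\<And>g. u differentiable (at g)" and dv: "\<And>g. v differentiable (at g)"
    using assms(1) class_C_2_imp_1[OF assms(2)] by (simp_all del: split_paired_All)
  have touch: "horizontal_gradient v g = horizontal_gradient u g" if "g \<in> frontier \<Omega>" for g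
  proof (rule horizontal_gradient_touching[OF du dv assms(7)])
    have "u g = 0" "v g = 0"
      using that assms(12,13) by blast+
    then show "u g = v g"
      by simp
  qed
  show ?thesis
  proof (intro conjI ballI allI impI subsetI)
    fix g assume "g \<in> frontier \<Omega>"
    then show "\<exists>s\<in>{0<..1}. horizontal_gradient v g = s *\<^sub>R horizontal_gradient u g"
      using touch by (intro bexI[of _ 1]) auto
  next
    fix V p
    assume prof: "has_radial_profile v V"
      and neg: "\<forall>x y t r. (x, y, t) \<in> closure \<Omega> \<and> r = sqrt (x\<^sup>2 + y\<^sup>2) \<and> r > 0 \<longrightarrow>
               r ^ 3 * (part_r (part_t V) r t)\<^sup>2 - part_r V r t * part_r (part_r V) r t < 0"
      and "p \<in> H_subdifferential_set v \<Omega>"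
    then obtain x y t where g: "(x, y, t) \<in> \<Omega>" and "p \<in> H_subdifferential v (x, y, t)"
      by (auto simp: H_subdifferential_set_def)
    then have p: "p = horizontal_gradient v (x, y, t)"
      using H_subdifferential_imp_gradient[OF dv] by blast
    define r where "r = sqrt (x\<^sup>2 + y\<^sup>2)"
    have r: "0 \<le> r"
      by (simp add: r_def)
    obtain c s where cs: "c\<^sup>2 + s\<^sup>2 = 1" "(x, y, t) = rot c s (r, 0, t)"
      unfolding r_def by (rule rot_to_half_plane)
    have norm_p: "norm p = norm (horizontal_gradient v (r, 0, t))"
      unfolding p cs(2) by (rule norm_horizontal_gradient_rot[OF assms(4) dv cs(1)])
    have "v (x, y, t) < 0"
      using g assms(9) by blast
    then have "v (r, 0, t) < 0"
      using radial_rot[OF assms(4) cs(1), of "(r, 0, t)"] cs(2) by simp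
    moreover have "continuous_on UNIV v"
      using dv by (simp add: differentiable_imp_continuous_on differentiable_on_def)
    ultimately obtain R where R: "r < R" "v (R, 0, t) = 0"
      using ray_exit assms(9,11) by metis
    \<comment> \<open>So far \<open>R\<close> is just some zero of \<open>v\<close> beyond
      \<open>r\<close>. Monotonicity along the ray puts everything before it in
      \<open>\<Omega>\<close>, where the hypothesis on \<open>V\<close> is available.\<close>
    have inside: "(z, 0, t) \<in> \<Omega>" if "0 \<le> z" "z < R" for z
      using radial_strictly_convex_less[OF assms(4,6) that, of t] R(2) assms(9) by simp
    have "z ^ 3 * (part_r (part_t V) z t)\<^sup>2 - part_r V z t * part_r (part_r V) z t < 0"
      if "0 < z" "z < R" for z
    proof -
      have "(z, 0, t) \<in> closure \<Omega>" "z = sqrt (z\<^sup>2 + 0\<^sup>2)"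
        using inside[of z] closure_subset that by auto
      then show ?thesis
        using neg that by blast
    qed
    then have "norm p < norm (horizontal_gradient v (R, 0, t))"
      unfolding norm_p by (rule norm_gradient_strict_increasing[OF assms(2) prof _ r R(1)])
    also have "\<dots> = norm (horizontal_gradient u (R, 0, t))"
      using touch[of "(R, 0, t)"] R(2) assms(13) by simp
    finally have less: "norm p < norm (horizontal_gradient u (R, 0, t))" .
    \<comment> \<open>On the same ray the norm of the gradient of \<open>u\<close> runs from 0 on
      the axis to a value above \<open>norm p\<close> at \<open>R\<close>; the radius
      \<open>z\<close> found may differ from \<open>r\<close>.\<close>
    obtain z where z: "0 \<le> z" "z \<le> R" "norm (horizontal_gradient u (z, 0, t)) = norm p"
      using IVT'[of "\<lambda>z. norm (horizontal_gradient u (z, 0, t))" 0 "norm p" R] less r R(1)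
        continuous_on_norm_gradient_half_plane[OF assms(1,3)]
        horizontal_gradient_axis[OF assms(3) du]
      by auto
    \<comment> \<open>The strict inequality excludes the boundary point, so \<open>z\<close> lies in
      the part of the ray inside \<open>\<Omega>\<close>.\<close>
    then have "z < R"
      using less by (cases "z = R") auto
    then have "(z, 0, t) \<in> \<Omega>"
      using inside z(1) by blast
    obtain a b a' b' where ab: "horizontal_gradient u (z, 0, t) = (a, b)" "p = (a', b')"
      by fastforce
    then have "a\<^sup>2 + b\<^sup>2 = a'\<^sup>2 + b'\<^sup>2"
      using z(3) by (simp add: norm_prod_def)
    \<comment> \<open>Equal lengths allow a rotation taking the gradient of \<open>u\<close> at
      \<open>(z, 0, t)\<close> to \<open>p\<close>. By equivariance \<open>p\<close> is the gradient
      at the rotated point, which stays in \<open>\<Omega>\<close> because \<open>u\<close> is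
      radial.\<close>
    then obtain c' s' where cs': "c'\<^sup>2 + s'\<^sup>2 = 1" "a' = c' * a - s' * b" "b' = s' * a + c' * b"
      by (rule rotation_transitive)
    define g' where "g' = rot c' s' (z, 0, t)"
    have "p = horizontal_gradient u g'"
      using horizontal_gradient_rot[OF assms(3) du cs'(1) ab(1)] ab(2) cs'(2,3)
      by (simp add: g'_def)
    then have "p \<in> H_subdifferential u g'"
      using gradient_in_H_subdifferential[OF _ du] assms(5)
      by (simp add: heis_strictly_convex_def)
    moreover have "g' \<in> \<Omega>"
      using \<open>(z, 0, t) \<in> \<Omega>\<close> radial_rot[OF assms(3) cs'(1)] assms(8) by (simp add: g'_def)
    ultimately show "p \<in> H_subdifferential_set u \<Omega>"
      by (auto simp: H_subdifferential_set_def)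
  qed
qed

end
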